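(* Suppose that $\mathbb{E}\|Z\| < \infty$, and let $\mu := \mathbb{E} Z$. Then \[ \lim_{n\to\infty} n^{-1} D_n = \|\mu\|, \quad \text{almost surely and in } L^1. \] On the other hand, if $\mathbb{E}\|Z\| = \infty$, then $\limsup_{n\to\infty} n^{-1} D_n = \infty$ almost surely.
   Context: Let $Z, Z_1, Z_2, \ldots$ be i.i.d. random variables in $\mathbb{R}^2$, and let $S_0 := \mathbf{0}$ (the origin) and $S_n := \sum_{k=1}^n Z_k$ for $n \ge 1$. Let $D_n := \operatorname{diam}\{S_0, S_1, \ldots, S_n\} = \max_{0\le i,j\le n}\|S_j - S_i\|$ (equivalently, the diameter of the convex hull of these points). Here $\|\cdot\|$ is the Euclidean norm on $\mathbb{R}^2$. *)

theory Defs
  imports "HOL-Probability.Probability"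
begin

text \<open>Only the steps with index at least 1 are used; \<open>Z 0\<close> plays no role.\<close>

definition walk :: "(nat \<Rightarrow> 'w \<Rightarrow> real ^ 2) \<Rightarrow> nat \<Rightarrow> 'w \<Rightarrow> real ^ 2" where
  "walk Z n \<omega> = (\<Sum>k = 1..n. Z k \<omega>)"

definition walk_diameter :: "(nat \<Rightarrow> 'w \<Rightarrow> real ^ 2) \<Rightarrow> nat \<Rightarrow> 'w \<Rightarrow> real" where
  "walk_diameter Z n \<omega> = diameter ((\<lambda>k. walk Z k \<omega>) ` {0..n})"

text \<open>Integrability is required explicitly, because the Bochner integral of a non-integrable
  function is 0 by convention.\<close>

definition tendsto_L1 :: "'w measure \<Rightarrow> (nat \<Rightarrow> 'w \<Rightarrow> real) \<Rightarrow> ('w \<Rightarrow> real) \<Rightarrow> bool" where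
  "tendsto_L1 M X Y \<longleftrightarrow>
     (\<forall>n. integrable M (X n)) \<and> integrable M Y \<and>
     (\<lambda>n. \<integral>\<omega>. \<bar>X n \<omega> - Y \<omega>\<bar> \<partial>M) \<longlonglongrightarrow> 0"

end

theory Submission
  imports Defs
begin

text \<open>
  If the steps are integrable with mean \<open>\<mu>\<close>, the strong law of large numbers says that the walk stays
  within \<open>o(n)\<close> of the straight line \<open>k \<mu>\<close>, \<open>k \<le> n\<close>. The diameter of the walk is therefore that of the
  segment from \<open>0\<close> to \<open>n \<mu>\<close> up to \<open>o(n)\<close> (\<open>diameter_asymptotics\<close>). For convergence in
  \<open>L\<^sup>1\<close>, the diameter is at most the length of the path, that is, the sum of the norms of the steps.
  Divided by \<open>n\<close>, this sum converges almost surely to the mean norm, again by the strong law, and its own mean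
  is constantly equal to that limit. A form of dominated convergence with a convergent sequence of dominating
  functions (\<open>tendsto_L1_squeeze\<close>) applies.

  The strong law is proved through a drift criterion: partial sums of i.i.d. variables with negative mean are
  almost surely bounded above (\<open>partial_sums_bdd_above\<close>). If they were not, then by the 0-1 law their
  running maximum would tend to infinity almost surely. Comparing the running maximum with that of the shifted
  sequence, which has the same law, would then force the mean of a step to be nonnegative.

  If the steps are not integrable, then for each \<open>C\<close> the probabilities that the \<open>n\<close>-th step is longer than
  \<open>C n\<close> have a divergent sum. By the second Borel--Cantelli lemma such steps occur infinitely often, and the
  diameter at time \<open>n\<close> is at least the length of the \<open>n\<close>-th step.
\<close>

section \<open>Running maxima of partial sums\<close>

text \<open>The maximum of \<open>0\<close> and the first \<open>n\<close> partial sums of \<open>x\<close>, written in the form of the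
  Lindley recursion for waiting times. The recursion peels off the first step and so exposes how the
  maximum changes when the sequence is shifted, which is all that the strong law below uses.\<close>

primrec lindley :: "nat \<Rightarrow> (nat \<Rightarrow> real) \<Rightarrow> real" where
  "lindley 0 x = 0"
| "lindley (Suc n) x = max 0 (x 0 + lindley n (\<lambda>k. x (Suc k)))"

lemma lindley_nonneg: "0 \<le> lindley n x"
  by (cases n) auto

lemma lindley_mono: "lindley n x \<le> lindley (Suc n) x"
proof (induction n arbitrary: x)
  case (Suc n)
  have "lindley n (\<lambda>k. x (Suc k)) \<le> lindley (Suc n) (\<lambda>k. x (Suc k))"
    by (rule Suc.IH)
  then show ?case
    unfolding lindley.simps(2)[of "Suc n" x] lindley.simps(2)[of n x] by linarith
qed auto

lemma partial_sum_le_lindley: "(\<Sum>k<n. x k) \<le> lindley n x"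
proof (induction n arbitrary: x)
  case (Suc n)
  have "(\<Sum>k<Suc n. x k) = x 0 + (\<Sum>k<n. x (Suc k))"
    by (rule sum.lessThan_Suc_shift)
  also have "\<dots> \<le> x 0 + lindley n (\<lambda>k. x (Suc k))"
    using Suc.IH by simp
  finally show ?case by simp
qed auto

lemma lindley_le_sum_abs: "lindley n x \<le> (\<Sum>k<n. \<bar>x k\<bar>)"
proof (induction n arbitrary: x)
  case (Suc n)
  have "lindley (Suc n) x \<le> \<bar>x 0\<bar> + (\<Sum>k<n. \<bar>x (Suc k)\<bar>)"
    using Suc.IH[of "\<lambda>k. x (Suc k)"] lindley_nonneg[of n "\<lambda>k. x (Suc k)"]
    unfolding lindley.simps by linarith
  then show ?case
    by (simp only: sum.lessThan_Suc_shift)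
qed auto

text \<open>The identity behind the strong law: once the running maximum of the shifted sequence exceeds
  \<open>- x 0\<close>, the difference of the two running maxima is exactly the first step.\<close>

lemma lindley_increment:
  "lindley (Suc n) x - lindley n (\<lambda>k. x (Suc k)) = max (- lindley n (\<lambda>k. x (Suc k))) (x 0)"
  unfolding lindley.simps by linarith

lemma lindley_at_top:
  assumes "\<not> bdd_above (range (\<lambda>n. \<Sum>k<n. x k))"
  shows "filterlim (\<lambda>n. lindley n x) at_top sequentially"
  unfolding filterlim_at_top eventually_sequentially
proof
  fix C :: real
  obtain m where m: "C < (\<Sum>k<m. x k)"
    using assms by (force simp: bdd_above_def not_le)
  have "incseq (\<lambda>n. lindley n x)"
    by (intro incseq_SucI lindley_mono)
  then have "C \<le> lindley n x" if "m \<le> n" for n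
    using m partial_sum_le_lindley[of x m] incseqD[of "\<lambda>n. lindley n x" m n] that by linarith
  then show "\<exists>N. \<forall>n\<ge>N. C \<le> lindley n x"
    by blast
qed

lemma borel_measurable_lindley:
  "lindley n \<in> borel_measurable (Pi\<^sub>M UNIV (\<lambda>_. borel))"
proof (induction n)
  case (Suc n)
  have "(\<lambda>x. \<lambda>k\<in>UNIV. x (Suc k)) \<in> measurable (Pi\<^sub>M UNIV (\<lambda>_. borel)) (Pi\<^sub>M UNIV (\<lambda>_. borel :: real measure))"
    by (intro measurable_restrict measurable_component_singleton) auto
  from measurable_compose[OF this Suc.IH]
  have [measurable]: "(\<lambda>x. lindley n (\<lambda>k. x (Suc k))) \<in> borel_measurable (Pi\<^sub>M UNIV (\<lambda>_. borel))"
    by (simp add: restrict_UNIV)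
  show ?case
    unfolding lindley.simps by measurable
qed simp

lemma bdd_above_partial_sums_shift:
  fixes x :: "nat \<Rightarrow> real"
  shows "bdd_above (range (\<lambda>n. \<Sum>k<n. x (k + m))) \<longleftrightarrow> bdd_above (range (\<lambda>n. \<Sum>k<n. x k))"
proof -
  have eq: "(\<Sum>k<n + m. x k) = (\<Sum>k<m. x k) + (\<Sum>k<n. x (k + m))" for n
  proof (induction n)
    case (Suc n)
    then show ?case by (simp add: add.assoc)
  qed simp
  have "bdd_above (range (\<lambda>n. \<Sum>k<n. x (k + m))) \<longleftrightarrow> bdd_above (range (\<lambda>n. \<Sum>k<n + m. x k))"
  proof
    assume "bdd_above (range (\<lambda>n. \<Sum>k<n. x (k + m)))"
    then obtain C where "\<And>n. (\<Sum>k<n. x (k + m)) \<le> C"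
      by (auto simp: bdd_above_def)
    then show "bdd_above (range (\<lambda>n. \<Sum>k<n + m. x k))"
      unfolding eq by (intro bdd_aboveI2[where M = "(\<Sum>k<m. x k) + C"]) auto
  next
    assume "bdd_above (range (\<lambda>n. \<Sum>k<n + m. x k))"
    then obtain C where "\<And>n. (\<Sum>k<n + m. x k) \<le> C"
      by (auto simp: bdd_above_def)
    then show "bdd_above (range (\<lambda>n. \<Sum>k<n. x (k + m)))"
      unfolding eq by (intro bdd_aboveI2[where M = "C - (\<Sum>k<m. x k)"]) (simp add: algebra_simps)
  qed
  also have "\<dots> \<longleftrightarrow> bdd_above (range (\<lambda>n. \<Sum>k<n. x k))"
  proof
    assume "bdd_above (range (\<lambda>n. \<Sum>k<n + m. x k))"
    then have "bdd_above ((\<lambda>n. \<Sum>k<n. x k) ` {..<m} \<union> range (\<lambda>n. \<Sum>k<n + m. x k))"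
      by simp
    moreover have "range (\<lambda>n. \<Sum>k<n. x k) \<subseteq> (\<lambda>n. \<Sum>k<n. x k) ` {..<m} \<union> range (\<lambda>n. \<Sum>k<n + m. x k)"
    proof (intro subsetI, elim rangeE)
      fix y n assume y: "y = (\<Sum>k<n. x k)"
      show "y \<in> (\<lambda>n. \<Sum>k<n. x k) ` {..<m} \<union> range (\<lambda>n. \<Sum>k<n + m. x k)"
      proof (cases "n < m")
        case False
        then have "y = (\<Sum>k<(n - m) + m. x k)"
          using y by simp
        then show ?thesis by blast
      qed (use y in blast)
    qed
    ultimately show "bdd_above (range (\<lambda>n. \<Sum>k<n. x k))"
      by (rule bdd_above_mono)
  next
    assume "bdd_above (range (\<lambda>n. \<Sum>k<n. x k))"
    then show "bdd_above (range (\<lambda>n. \<Sum>k<n + m. x k))"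
      by (rule bdd_above_mono) blast
  qed
  finally show ?thesis .
qed

section \<open>Independent and identically distributed variables\<close>

context prob_space begin

lemma indep_vars_random_variable:
  "indep_vars M' X I \<Longrightarrow> i \<in> I \<Longrightarrow> random_variable (M' i) (X i)"
  unfolding indep_vars_def2 by blast

lemma indep_vars_reindex:
  assumes indep: "indep_vars M' X I" and f: "inj_on f J" "f ` J \<subseteq> I"
  shows "indep_vars (\<lambda>j. M' (f j)) (\<lambda>j. X (f j)) J"
  unfolding indep_vars_def2
proof (intro conjI ballI indep_setsI)
  fix j assume "j \<in> J"
  then show "random_variable (M' (f j)) (X (f j))"
    using indep f(2) unfolding indep_vars_def2 by blast
next
  fix j assume "j \<in> J"
  then show "{X (f j) -` A \<inter> space M |A. A \<in> sets (M' (f j))} \<subseteq> events"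
    using indep f(2) unfolding indep_vars_def2 indep_sets_def by blast
next
  fix B K
  assume K: "K \<noteq> {}" "K \<subseteq> J" "finite K"
    and B: "\<forall>j\<in>K. B j \<in> {X (f j) -` A \<inter> space M |A. A \<in> sets (M' (f j))}"
  have inj: "inj_on f K"
    using f K by (auto intro: inj_on_subset)
  define C where "C i = B (the_inv_into K f i)" for i
  have C: "C (f j) = B j" if "j \<in> K" for j
    using that inj by (simp add: C_def the_inv_into_f_f)
  have "prob (\<Inter>i\<in>f ` K. C i) = (\<Prod>i\<in>f ` K. prob (C i))"
  proof (rule indep_setsD)
    show "indep_sets (\<lambda>i. {X i -` A \<inter> space M |A. A \<in> sets (M' i)}) I"
      using indep by (simp add: indep_vars_def2)
  qed (use K f B C in auto)
  then show "prob (\<Inter>j\<in>K. B j) = (\<Prod>j\<in>K. prob (B j))"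
    using inj C by (simp add: prod.reindex)
qed

lemma identically_distributed_compose:
  assumes [measurable]: "X \<in> borel_measurable M" "Y \<in> borel_measurable M" "f \<in> borel_measurable borel"
    and eq: "distr M borel X = distr M borel Y"
  shows "distr M borel (\<lambda>\<omega>. f (X \<omega>)) = distr M borel (\<lambda>\<omega>. f (Y \<omega>))"
proof -
  have "distr M borel (\<lambda>\<omega>. f (X \<omega>)) = distr (distr M borel X) borel f"
    by (subst distr_distr) (auto simp: comp_def)
  also have "\<dots> = distr (distr M borel Y) borel f"
    by (simp only: eq)
  also have "\<dots> = distr M borel (\<lambda>\<omega>. f (Y \<omega>))"
    by (subst distr_distr) (auto simp: comp_def)
  finally show ?thesis .
qed

lemma identically_distributed_integral:
  fixes X Y :: "'a \<Rightarrow> 'b::{banach, second_countable_topology}"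
  assumes [measurable]: "X \<in> borel_measurable M" "Y \<in> borel_measurable M"
    and eq: "distr M borel X = distr M borel Y"
  shows "integrable M X \<longleftrightarrow> integrable M Y" "(\<integral>\<omega>. X \<omega> \<partial>M) = (\<integral>\<omega>. Y \<omega> \<partial>M)"
proof -
  have "integrable M X \<longleftrightarrow> integrable (distr M borel X) (\<lambda>x. x)"
    by (subst integrable_distr_eq) auto
  also have "\<dots> \<longleftrightarrow> integrable M Y"
    unfolding eq by (subst integrable_distr_eq) auto
  finally show "integrable M X \<longleftrightarrow> integrable M Y" .
  have "(\<integral>\<omega>. X \<omega> \<partial>M) = (\<integral>x. x \<partial>distr M borel X)"
    by (subst integral_distr) auto
  also have "\<dots> = (\<integral>\<omega>. Y \<omega> \<partial>M)"
    unfolding eq by (subst integral_distr) auto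
  finally show "(\<integral>\<omega>. X \<omega> \<partial>M) = (\<integral>\<omega>. Y \<omega> \<partial>M)" .
qed

section \<open>The strong law of large numbers\<close>

text \<open>Dropping finitely many steps changes all later partial sums by a constant, so unboundedness of
  the partial sums is a tail event and Kolmogorov's 0-1 law applies.\<close>

lemma partial_sums_unbounded_0_1:
  fixes X :: "nat \<Rightarrow> 'a \<Rightarrow> real"
  assumes indep: "indep_vars (\<lambda>_. borel) X UNIV"
  defines "U \<equiv> {\<omega>\<in>space M. \<not> bdd_above (range (\<lambda>n. \<Sum>k<n. X k \<omega>))}"
  shows "prob U = 0 \<or> prob U = 1" "U \<in> events"
proof -
  define A where "A i = sigma_sets (space M) {X i -` B \<inter> space M |B. B \<in> sets borel}" for i
  have [measurable]: "X i \<in> borel_measurable M" for i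
    using indep_vars_random_variable[OF indep] by simp
  have A_space: "A i \<subseteq> Pow (space M)" for i
    unfolding A_def by (intro subsetI PowI sigma_sets_into_sp) auto
  have tail: "U \<in> tail_events A"
    unfolding tail_events_def
  proof
    fix n
    define N where "N = sigma (space M) (\<Union>(A ` {n..}))"
    have "\<Union>(A ` {n..}) \<subseteq> Pow (space M)"
      using A_space by blast
    then have sets_N: "sets N = sigma_sets (space M) (\<Union>(A ` {n..}))" and space_N: "space N = space M"
      unfolding N_def by (auto intro: sets_measure_of space_measure_of)
    have [measurable]: "X (k + n) \<in> borel_measurable N" for k
    proof (rule measurableI)
      fix B :: "real set" assume "B \<in> sets borel"
      then have "X (k + n) -` B \<inter> space M \<in> A (k + n)"
        unfolding A_def by blast
      then show "X (k + n) -` B \<inter> space N \<in> sets N"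
        unfolding sets_N space_N by (intro sigma_sets.Basic) auto
    qed simp
    \<comment> \<open>Integer bounds suffice, so that \<open>U\<close> becomes a countable combination of events.\<close>
    have bdd: "bdd_above (range f) \<longleftrightarrow> (\<exists>C::nat. \<forall>m. f m \<le> real C)" for f :: "nat \<Rightarrow> real"
    proof
      assume "bdd_above (range f)"
      then obtain c where c: "\<And>m. f m \<le> c"
        by (auto simp: bdd_above_def)
      obtain C :: nat where "c \<le> real C"
        using real_arch_simple by blast
      then show "\<exists>C::nat. \<forall>m. f m \<le> real C"
        using c order_trans by blast
    qed (auto simp: bdd_above_def)
    have "U = {\<omega>\<in>space N. \<not> (\<exists>C::nat. \<forall>m. (\<Sum>k<m. X (k + n) \<omega>) \<le> real C)}"
      unfolding U_def space_N
      by (intro Collect_cong conj_cong refl)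
        (simp only: bdd_above_partial_sums_shift[of "\<lambda>k. X k _" n, symmetric] bdd)
    also have "\<dots> \<in> sets N"
      by measurable
    finally show "U \<in> sigma_sets (space M) (\<Union>(A ` {n..}))"
      by (simp add: sets_N)
  qed
  have indep_A: "indep_sets A UNIV"
    using indep unfolding indep_vars_def A_def by blast
  show "prob U = 0 \<or> prob U = 1"
  proof (rule kolmogorov_0_1_law[OF _ indep_A tail])
    show "sigma_algebra (space M) (A i)" for i
      unfolding A_def by (rule sigma_algebra_sigma_sets) auto
  qed
  have "A i \<subseteq> events" for i
    using indep_A unfolding indep_sets_def by simp
  then show "U \<in> events"
    using tail_events_sets tail by blast
qed

text \<open>Both laws are the same infinite product measure.\<close>

lemma iid_distr_shift:
  fixes X :: "nat \<Rightarrow> 'a \<Rightarrow> real"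
  assumes indep: "indep_vars (\<lambda>_. borel) X UNIV"
    and ident: "\<And>k. distr M borel (X k) = distr M borel (X 0)"
  shows "distr M (Pi\<^sub>M UNIV (\<lambda>_. borel)) (\<lambda>\<omega> k. X (Suc k) \<omega>)
    = distr M (Pi\<^sub>M UNIV (\<lambda>_. borel)) (\<lambda>\<omega> k. X k \<omega>)"
proof -
  have *: "distr M (Pi\<^sub>M UNIV (\<lambda>_. borel)) (\<lambda>\<omega> k. Y k \<omega>) = Pi\<^sub>M UNIV (\<lambda>k. distr M borel (Y k))"
    if "indep_vars (\<lambda>_. borel) Y UNIV" for Y :: "nat \<Rightarrow> 'a \<Rightarrow> real"
  proof -
    have "random_variable borel (Y k)" for k
      by (rule indep_vars_random_variable[OF that UNIV_I])
    then have "distr M (Pi\<^sub>M UNIV (\<lambda>_. borel)) (\<lambda>\<omega>. \<lambda>k\<in>UNIV. Y k \<omega>) = Pi\<^sub>M UNIV (\<lambda>k. distr M borel (Y k))"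
      using indep_vars_iff_distr_eq_PiM[where I = UNIV and M' = "\<lambda>_. borel" and X = Y, THEN iffD1,
          OF UNIV_not_empty _ that] by fast
    then show ?thesis
      by (simp only: restrict_UNIV)
  qed
  have "indep_vars (\<lambda>_. borel) (\<lambda>k. X (Suc k)) UNIV"
    using indep_vars_reindex[OF indep, of Suc UNIV] by simp
  moreover have "distr M borel (X (Suc k)) = distr M borel (X k)" for k
    by (rule trans[OF ident ident[symmetric]])
  ultimately show ?thesis
    using *[of "\<lambda>k. X (Suc k)"] *[of X] indep by simp
qed

text \<open>By the 0-1 law it is enough to exclude that the partial sums are almost surely unbounded above.
  Let \<open>L n\<close> and \<open>L' n\<close> be the running maxima of the sequence and of the shifted sequence. By stationarity
  they have the same mean, so \<open>L (n + 1) - L' n\<close> has nonnegative mean because \<open>L\<close> increases in \<open>n\<close>.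
  That difference equals \<open>max (- L' n) (X 0)\<close>. It is dominated by \<open>\<bar>X 0\<bar>\<close>, and it would converge to
  \<open>X 0\<close> if \<open>L' n\<close> tended to infinity; then \<open>X 0\<close> would have nonnegative mean.\<close>

lemma partial_sums_bdd_above:
  fixes X :: "nat \<Rightarrow> 'a \<Rightarrow> real"
  assumes indep: "indep_vars (\<lambda>_. borel) X UNIV"
    and ident: "\<And>k. distr M borel (X k) = distr M borel (X 0)"
    and int: "integrable M (X 0)" and neg: "expectation (X 0) < 0"
  shows "AE \<omega> in M. bdd_above (range (\<lambda>n. \<Sum>k<n. X k \<omega>))"
proof -
  define U where "U = {\<omega>\<in>space M. \<not> bdd_above (range (\<lambda>n. \<Sum>k<n. X k \<omega>))}"
  note U = partial_sums_unbounded_0_1[OF indep, folded U_def]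
  have X_meas [measurable]: "X k \<in> borel_measurable M" for k
    using indep_vars_random_variable[OF indep] by simp
  have int_X: "integrable M (X k)" for k
    using identically_distributed_integral(1)[OF X_meas X_meas ident] int by blast
  define L where "L = (\<lambda>n \<omega>. lindley n (\<lambda>k. X k \<omega>))"
  define L' where "L' = (\<lambda>n \<omega>. lindley n (\<lambda>k. X (Suc k) \<omega>))"
  have proc: "(\<lambda>\<omega> k. Y k \<omega>) \<in> measurable M (Pi\<^sub>M UNIV (\<lambda>_. borel))"
    if "\<And>k. Y k \<in> borel_measurable M" for Y :: "nat \<Rightarrow> 'a \<Rightarrow> real"
    using measurable_restrict[of UNIV Y M "\<lambda>_. borel"] that by (simp add: restrict_UNIV)
  have int_lindley: "integrable M (\<lambda>\<omega>. lindley n (\<lambda>k. Y k \<omega>))"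
    if "\<And>k. integrable M (Y k)" for Y and n
  proof (rule Bochner_Integration.integrable_bound)
    show "integrable M (\<lambda>\<omega>. \<Sum>k<n. \<bar>Y k \<omega>\<bar>)"
      using that by (intro Bochner_Integration.integrable_sum integrable_abs)
    show "(\<lambda>\<omega>. lindley n (\<lambda>k. Y k \<omega>)) \<in> borel_measurable M"
      using that by (intro measurable_compose[OF proc borel_measurable_lindley] borel_measurable_integrable)
    show "AE \<omega> in M. norm (lindley n (\<lambda>k. Y k \<omega>)) \<le> norm (\<Sum>k<n. \<bar>Y k \<omega>\<bar>)"
      by (simp add: lindley_nonneg sum_nonneg lindley_le_sum_abs)
  qed
  have int_L: "integrable M (L n)" and int_L': "integrable M (L' n)" for n
    unfolding L_def L'_def by (intro int_lindley int_X)+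
  have [measurable]: "L n \<in> borel_measurable M" "L' n \<in> borel_measurable M" for n
    using int_L int_L' by blast+
  have EL': "expectation (L' n) = expectation (L n)" for n
  proof -
    have "expectation (L' n)
        = (\<integral>x. lindley n x \<partial>distr M (Pi\<^sub>M UNIV (\<lambda>_. borel)) (\<lambda>\<omega> k. X (Suc k) \<omega>))"
      unfolding L'_def by (rule integral_distr[symmetric, OF proc[OF X_meas] borel_measurable_lindley])
    also have "\<dots> = (\<integral>x. lindley n x \<partial>distr M (Pi\<^sub>M UNIV (\<lambda>_. borel)) (\<lambda>\<omega> k. X k \<omega>))"
      by (subst iid_distr_shift[OF indep ident]) (rule refl)
    also have "\<dots> = expectation (L n)"
      unfolding L_def by (rule integral_distr[OF proc[OF X_meas] borel_measurable_lindley])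
    finally show ?thesis .
  qed
  have incr: "L (Suc n) \<omega> - L' n \<omega> = max (- L' n \<omega>) (X 0 \<omega>)" for n \<omega>
    unfolding L_def L'_def by (rule lindley_increment)
  have nonneg: "0 \<le> expectation (\<lambda>\<omega>. max (- L' n \<omega>) (X 0 \<omega>))" for n
  proof -
    have "expectation (L n) \<le> expectation (L (Suc n))"
      unfolding L_def by (intro integral_mono int_lindley int_X lindley_mono)
    then show ?thesis
      unfolding incr[symmetric] Bochner_Integration.integral_diff[OF int_L int_L'] EL' by simp
  qed
  have "prob U \<noteq> 1"
  proof
    assume "prob U = 1"
    then have "AE \<omega> in M. \<omega> \<in> U"
      using prob_eq_1[OF U(2)] by blast
    then have lim: "AE \<omega> in M. (\<lambda>n. max (- L' n \<omega>) (X 0 \<omega>)) \<longlonglongrightarrow> X 0 \<omega>"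
    proof eventually_elim
      case (elim \<omega>)
      then have "\<not> bdd_above (range (\<lambda>n. \<Sum>k<n. X (Suc k) \<omega>))"
        using bdd_above_partial_sums_shift[of "\<lambda>k. X k \<omega>" 1] by (simp add: U_def)
      then have "filterlim (\<lambda>n. L' n \<omega>) at_top sequentially"
        unfolding L'_def by (rule lindley_at_top)
      then have "eventually (\<lambda>n. - X 0 \<omega> \<le> L' n \<omega>) sequentially"
        by (simp add: filterlim_at_top)
      then have "eventually (\<lambda>n. max (- L' n \<omega>) (X 0 \<omega>) = X 0 \<omega>) sequentially"
        by eventually_elim auto
      then show ?case by (rule tendsto_eventually)
    qed
    have "(\<lambda>n. expectation (\<lambda>\<omega>. max (- L' n \<omega>) (X 0 \<omega>))) \<longlonglongrightarrow> expectation (X 0)"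
    proof (rule integral_dominated_convergence[OF _ _ _ lim])
      show "integrable M (\<lambda>\<omega>. \<bar>X 0 \<omega>\<bar>)" using int by simp
      show "AE \<omega> in M. norm (max (- L' n \<omega>) (X 0 \<omega>)) \<le> \<bar>X 0 \<omega>\<bar>" for n
      proof (rule AE_I2)
        fix \<omega>
        have "0 \<le> L' n \<omega>"
          unfolding L'_def by (rule lindley_nonneg)
        then show "norm (max (- L' n \<omega>) (X 0 \<omega>)) \<le> \<bar>X 0 \<omega>\<bar>"
          unfolding real_norm_def by linarith
      qed
      show "X 0 \<in> borel_measurable M"
        by (rule X_meas)
      show "(\<lambda>\<omega>. max (- L' n \<omega>) (X 0 \<omega>)) \<in> borel_measurable M" for n
        by measurable
    qed
    then have "0 \<le> expectation (X 0)"
      by (rule LIMSEQ_le_const) (use nonneg in blast)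
    with neg show False by simp
  qed
  with U have "prob U = 0" by blast
  then have "AE \<omega> in M. \<omega> \<notin> U"
    using prob_eq_0[OF U(2)] by blast
  with AE_space show ?thesis
    by eventually_elim (simp add: U_def)
qed

text \<open>Subtracting a \<open>d\<close> strictly between the mean and \<open>c\<close> gives a walk with negative drift. Its
  partial sums are bounded by a (random) constant, which is negligible compared with \<open>(c - d) n\<close>.\<close>

lemma strong_law_upper:
  fixes X :: "nat \<Rightarrow> 'a \<Rightarrow> real"
  assumes indep: "indep_vars (\<lambda>_. borel) X UNIV"
    and ident: "\<And>k. distr M borel (X k) = distr M borel (X 0)"
    and int: "integrable M (X 0)" and "expectation (X 0) < c"
  shows "AE \<omega> in M. eventually (\<lambda>n. (\<Sum>k<n. X k \<omega>) / real n < c) sequentially"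
proof -
  obtain d where d: "expectation (X 0) < d" "d < c"
    using assms dense by blast
  have [measurable]: "X k \<in> borel_measurable M" for k
    using indep_vars_random_variable[OF indep] by simp
  have "AE \<omega> in M. bdd_above (range (\<lambda>n. \<Sum>k<n. X k \<omega> - d))"
  proof (rule partial_sums_bdd_above)
    show "indep_vars (\<lambda>_. borel) (\<lambda>k \<omega>. X k \<omega> - d) UNIV"
      by (rule indep_vars_compose2[OF indep]) auto
    show "distr M borel (\<lambda>\<omega>. X k \<omega> - d) = distr M borel (\<lambda>\<omega>. X 0 \<omega> - d)" for k
      by (rule identically_distributed_compose[OF _ _ _ ident]) measurable
  qed (use int d in \<open>auto simp: prob_space\<close>)
  then show ?thesis
  proof eventually_elim
    case (elim \<omega>)
    then obtain C where C: "\<And>n. (\<Sum>k<n. X k \<omega> - d) \<le> C"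
      by (auto simp: bdd_above_def)
    have "eventually (\<lambda>n. C / (c - d) < real n \<and> 0 < n) sequentially"
      by (intro eventually_conj eventually_gt_at_top
          filterlim_at_top_dense[THEN iffD1, OF filterlim_real_sequentially, rule_format])
    then show ?case
    proof eventually_elim
      case (elim n)
      then have "C < real n * (c - d)"
        using d by (simp add: field_simps)
      then have "(\<Sum>k<n. X k \<omega>) < real n * c"
        using C[of n] by (simp add: sum_subtractf algebra_simps)
      then show ?case using elim by (simp add: field_simps)
    qed
  qed
qed

text \<open>The upper bound for \<open>X\<close> and for \<open>- X\<close>, along a countable sequence of margins.\<close>

theorem strong_law_real:
  fixes X :: "nat \<Rightarrow> 'a \<Rightarrow> real"
  assumes indep: "indep_vars (\<lambda>_. borel) X UNIV"
    and ident: "\<And>k. distr M borel (X k) = distr M borel (X 0)"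
    and int: "integrable M (X 0)"
  shows "AE \<omega> in M. (\<lambda>n. (\<Sum>k<n. X k \<omega>) / real n) \<longlonglongrightarrow> expectation (X 0)"
proof -
  have [measurable]: "X k \<in> borel_measurable M" for k
    using indep_vars_random_variable[OF indep] by simp
  define e where "e m = inverse (real (Suc m))" for m
  have e: "0 < e m" for m by (simp add: e_def)
  have "AE \<omega> in M. eventually (\<lambda>n. (\<Sum>k<n. X k \<omega>) / real n < expectation (X 0) + e m) sequentially" for m
    using strong_law_upper[OF indep ident int, of "expectation (X 0) + e m"] e by simp
  moreover have "AE \<omega> in M. eventually (\<lambda>n. (\<Sum>k<n. - X k \<omega>) / real n < - expectation (X 0) + e m) sequentially" for m
  proof (rule strong_law_upper)
    show "indep_vars (\<lambda>_. borel) (\<lambda>k \<omega>. - X k \<omega>) UNIV"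
      by (rule indep_vars_compose2[OF indep]) auto
    show "distr M borel (\<lambda>\<omega>. - X k \<omega>) = distr M borel (\<lambda>\<omega>. - X 0 \<omega>)" for k
      by (rule identically_distributed_compose[OF _ _ _ ident]) measurable
  qed (use int e in auto)
  ultimately have "AE \<omega> in M. \<forall>m. eventually (\<lambda>n. (\<Sum>k<n. X k \<omega>) / real n < expectation (X 0) + e m) sequentially
      \<and> eventually (\<lambda>n. (\<Sum>k<n. - X k \<omega>) / real n < - expectation (X 0) + e m) sequentially"
    by (simp add: AE_all_countable)
  then show ?thesis
  proof eventually_elim
    case (elim \<omega>)
    show ?case
    proof (rule tendstoI)
      fix r :: real assume "0 < r"
      then obtain m where m: "e m < r"
        unfolding e_def using reals_Archimedean by blast
      from elim[rule_format, of m, THEN conjunct1] elim[rule_format, of m, THEN conjunct2]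
      show "eventually (\<lambda>n. dist ((\<Sum>k<n. X k \<omega>) / real n) (expectation (X 0)) < r) sequentially"
        by eventually_elim (use m in \<open>auto simp: dist_real_def sum_negf abs_less_iff\<close>)
    qed
  qed
qed

text \<open>The one-dimensional law in each of the finitely many coordinates.\<close>

theorem strong_law_euclidean:
  fixes X :: "nat \<Rightarrow> 'a \<Rightarrow> 'b::euclidean_space"
  assumes indep: "indep_vars (\<lambda>_. borel) X UNIV"
    and ident: "\<And>k. distr M borel (X k) = distr M borel (X 0)"
    and int: "integrable M (X 0)"
  shows "AE \<omega> in M. (\<lambda>n. (\<Sum>k<n. X k \<omega>) /\<^sub>R real n) \<longlonglongrightarrow> (\<integral>\<omega>. X 0 \<omega> \<partial>M)"
proof -
  have [measurable]: "X k \<in> borel_measurable M" for k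
    by (rule indep_vars_random_variable[OF indep UNIV_I])
  have "AE \<omega> in M. (\<lambda>n. (\<Sum>k<n. X k \<omega> \<bullet> b) / real n) \<longlonglongrightarrow> (\<integral>\<omega>. X 0 \<omega> \<partial>M) \<bullet> b" for b :: 'b
  proof -
    have "AE \<omega> in M. (\<lambda>n. (\<Sum>k<n. X k \<omega> \<bullet> b) / real n) \<longlonglongrightarrow> expectation (\<lambda>\<omega>. X 0 \<omega> \<bullet> b)"
    proof (rule strong_law_real)
      show "indep_vars (\<lambda>_. borel) (\<lambda>k \<omega>. X k \<omega> \<bullet> b) UNIV"
        by (rule indep_vars_compose2[OF indep]) simp
      show "distr M borel (\<lambda>\<omega>. X k \<omega> \<bullet> b) = distr M borel (\<lambda>\<omega>. X 0 \<omega> \<bullet> b)" for k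
        by (rule identically_distributed_compose[OF _ _ _ ident]) measurable
      show "integrable M (\<lambda>\<omega>. X 0 \<omega> \<bullet> b)"
        using int by (rule integrable_inner_left)
    qed
    then show ?thesis
      by (simp add: int)
  qed
  then have "AE \<omega> in M. \<forall>b\<in>Basis. (\<lambda>n. (\<Sum>k<n. X k \<omega> \<bullet> b) / real n) \<longlonglongrightarrow> (\<integral>\<omega>. X 0 \<omega> \<partial>M) \<bullet> b"
    by (intro AE_finite_allI) auto
  then show ?thesis
  proof eventually_elim
    case (elim \<omega>)
    show ?case
    proof (rule tendsto_componentwise_iff[THEN iffD2], rule ballI)
      fix b :: 'b assume "b \<in> Basis"
      with elim show "(\<lambda>n. ((\<Sum>k<n. X k \<omega>) /\<^sub>R real n) \<bullet> b) \<longlonglongrightarrow> (\<integral>\<omega>. X 0 \<omega> \<partial>M) \<bullet> b"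
        by (simp add: inner_sum_left divide_inverse mult.commute)
    qed
  qed
qed

section \<open>The second Borel--Cantelli lemma and divergent tail sums\<close>

text \<open>The second Borel--Cantelli lemma. The probability that none of \<open>A m, \<dots>, A (m + j - 1)\<close> occurs
  is a product of factors \<open>1 - p \<le> exp (- p)\<close>, hence at most the exponential of minus a divergent sum.\<close>

lemma borel_cantelli_independent:
  fixes A :: "nat \<Rightarrow> 'a set"
  assumes indep: "indep_events A UNIV" and div: "\<not> summable (\<lambda>n. prob (A n))"
  shows "AE \<omega> in M. \<exists>\<^sub>\<infinity>n. \<omega> \<in> A n"
proof -
  have A [measurable]: "A n \<in> events" for n
    using indep unfolding indep_events_def by blast
  have indep': "indep_sets (\<lambda>n. sigma_sets (space M) {A n}) UNIV"
    using indep unfolding indep_events_def_alt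
    by (rule indep_sets_sigma) (auto simp: Int_stable_def)
  have "AE \<omega> in M. \<exists>n\<ge>m. \<omega> \<in> A n" for m
  proof -
    define B where "B = {\<omega>\<in>space M. \<forall>n\<ge>m. \<omega> \<notin> A n}"
    have [measurable]: "B \<in> events" unfolding B_def by measurable
    have le: "prob B \<le> exp (- (\<Sum>n\<in>{m..<m + j}. prob (A n)))" if "0 < j" for j
    proof -
      have "prob B \<le> prob (\<Inter>n\<in>{m..<m + j}. space M - A n)"
        using that by (intro finite_measure_mono) (auto simp: B_def)
      also have "\<dots> = (\<Prod>n\<in>{m..<m + j}. prob (space M - A n))"
        using that by (intro indep_setsD[OF indep']) (auto intro: sigma_sets.intros)
      also have "\<dots> = (\<Prod>n\<in>{m..<m + j}. 1 - prob (A n))"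
        by (simp add: prob_compl)
      also have "\<dots> \<le> (\<Prod>n\<in>{m..<m + j}. exp (- prob (A n)))"
        by (intro prod_mono) (use exp_ge_add_one_self[of "- prob (A _)"] in auto)
      also have "\<dots> = exp (- (\<Sum>n\<in>{m..<m + j}. prob (A n)))"
        by (simp add: exp_sum[symmetric] sum_negf)
      finally show ?thesis .
    qed
    have "prob B \<le> 0"
    proof (rule ccontr)
      assume "\<not> prob B \<le> 0"
      \<comment> \<open>If \<open>B\<close> had positive probability, \<open>- ln (prob B)\<close> would bound all partial sums.\<close>
      have "summable (\<lambda>n. prob (A (n + m)))"
      proof (rule bounded_imp_summable)
        fix j
        have "(\<Sum>n\<le>j. prob (A (n + m))) = (\<Sum>n\<in>{m..<m + Suc j}. prob (A n))"
          by (rule sum.reindex_bij_witness[of _ "\<lambda>n. n - m" "\<lambda>n. n + m"]) auto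
        also have "\<dots> \<le> - ln (prob B)"
        proof -
          have "ln (prob B) \<le> ln (exp (- (\<Sum>n\<in>{m..<m + Suc j}. prob (A n))))"
            using le[of "Suc j"] \<open>\<not> prob B \<le> 0\<close> by (subst ln_le_cancel_iff) auto
          then show ?thesis by simp
        qed
        finally show "(\<Sum>n\<le>j. prob (A (n + m))) \<le> - ln (prob B)" .
      qed simp
      with div show False using summable_iff_shift[of "\<lambda>n. prob (A n)" m] by simp
    qed
    then have "AE \<omega> in M. \<omega> \<notin> B"
      by (simp add: prob_eq_0 measure_le_0_iff)
    then show ?thesis
      by (rule AE_mp) (auto intro!: AE_I2 simp: B_def)
  qed
  then have "AE \<omega> in M. \<forall>m. \<exists>n\<ge>m. \<omega> \<in> A n"
    by (simp add: AE_all_countable)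
  then show ?thesis
    by (simp add: INFM_nat_le)
qed

text \<open>\<open>Y / c\<close> is at most its ceiling, and the mean of that integer is the sum of its tail probabilities,
  which are the probabilities in question.\<close>

lemma tail_not_summable:
  fixes Y :: "'a \<Rightarrow> real"
  assumes [measurable]: "Y \<in> borel_measurable M" and "0 < c"
    and inf: "(\<integral>\<^sup>+\<omega>. ennreal (Y \<omega>) \<partial>M) = \<infinity>"
  shows "\<not> summable (\<lambda>n. prob {\<omega>\<in>space M. c * real n < Y \<omega>})"
proof
  assume summable: "summable (\<lambda>n. prob {\<omega>\<in>space M. c * real n < Y \<omega>})"
  have "(\<integral>\<^sup>+\<omega>. ennreal (Y \<omega>) \<partial>M) \<le> (\<integral>\<^sup>+\<omega>. ennreal c * of_nat (nat \<lceil>Y \<omega> / c\<rceil>) \<partial>M)"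
  proof (rule nn_integral_mono)
    fix \<omega>
    have "Y \<omega> / c \<le> real (nat \<lceil>Y \<omega> / c\<rceil>)"
      by (rule of_nat_ceiling)
    then have "Y \<omega> \<le> c * real (nat \<lceil>Y \<omega> / c\<rceil>)"
      using \<open>0 < c\<close> by (simp add: field_simps)
    then show "ennreal (Y \<omega>) \<le> ennreal c * of_nat (nat \<lceil>Y \<omega> / c\<rceil>)"
      using \<open>0 < c\<close> by (simp add: ennreal_of_nat_eq_real_of_nat flip: ennreal_mult')
  qed
  also have "\<dots> = ennreal c * (\<integral>\<^sup>+\<omega>. of_nat (nat \<lceil>Y \<omega> / c\<rceil>) \<partial>M)"
    by (intro nn_integral_cmult) measurable
  also have "(\<integral>\<^sup>+\<omega>. of_nat (nat \<lceil>Y \<omega> / c\<rceil>) \<partial>M)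
      = (\<Sum>n. emeasure M {\<omega>\<in>space M. n < nat \<lceil>Y \<omega> / c\<rceil>})"
    by (rule nn_integral_nat_function) measurable
  also have "\<dots> = (\<Sum>n. ennreal (prob {\<omega>\<in>space M. c * real n < Y \<omega>}))"
  proof (intro suminf_cong)
    fix n
    have "n < nat \<lceil>Y \<omega> / c\<rceil> \<longleftrightarrow> c * real n < Y \<omega>" for \<omega>
    proof -
      have "n < nat \<lceil>Y \<omega> / c\<rceil> \<longleftrightarrow> real n < Y \<omega> / c"
        by (simp add: zless_nat_eq_int_zless less_ceiling_iff)
      then show ?thesis using \<open>0 < c\<close> by (simp add: field_simps)
    qed
    then show "emeasure M {\<omega>\<in>space M. n < nat \<lceil>Y \<omega> / c\<rceil>}
        = ennreal (prob {\<omega>\<in>space M. c * real n < Y \<omega>})"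
      by (simp add: emeasure_eq_measure)
  qed
  also have "\<dots> = ennreal (\<Sum>n. prob {\<omega>\<in>space M. c * real n < Y \<omega>})"
    by (rule suminf_ennreal2[OF _ summable]) simp
  also have "ennreal c * \<dots> < \<infinity>"
    by (simp add: ennreal_mult_less_top)
  finally show False
    using inf by simp
qed

section \<open>Convergence in mean\<close>

text \<open>A dominated convergence theorem with moving dominating functions. The error \<open>\<bar>W n - w\<bar>\<close> is split
  into a part that is bounded by a constant, namely the truncation error \<open>\<bar>min (W n) c - w\<bar>\<close> and the shortfall
  of \<open>T n\<close> below \<open>c\<close>, and the signed remainder \<open>T n - c\<close>. Bounded convergence handles the first part;
  only the mean of the second part matters, and it tends to \<open>0\<close>.\<close>

lemma tendsto_L1_squeeze:
  fixes W T :: "nat \<Rightarrow> 'a \<Rightarrow> real"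
  assumes W [measurable]: "\<And>n. W n \<in> borel_measurable M"
    and T: "\<And>n. integrable M (T n)"
    and le: "\<And>n \<omega>. 0 \<le> W n \<omega>" "\<And>n \<omega>. W n \<omega> \<le> T n \<omega>"
    and W_lim: "AE \<omega> in M. (\<lambda>n. W n \<omega>) \<longlonglongrightarrow> w"
    and T_lim: "AE \<omega> in M. (\<lambda>n. T n \<omega>) \<longlonglongrightarrow> c"
    and ET_lim: "(\<lambda>n. expectation (T n)) \<longlonglongrightarrow> c"
  shows "tendsto_L1 M W (\<lambda>_. w)"
proof -
  have T_meas [measurable]: "T n \<in> borel_measurable M" for n
    using T by (rule borel_measurable_integrable)
  have int_W: "integrable M (W n)" for n
  proof (rule Bochner_Integration.integrable_bound[OF T[of n] W[of n]], rule AE_I2)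
    show "norm (W n \<omega>) \<le> norm (T n \<omega>)" for \<omega>
      using le[of n \<omega>] unfolding real_norm_def by linarith
  qed
  have "AE \<omega> in M. w \<le> c"
    using W_lim T_lim by eventually_elim (rule LIMSEQ_le, assumption, assumption, intro exI allI impI le(2))
  then have "w \<le> c" by simp
  define g where "g n \<omega> = \<bar>min (W n \<omega>) c - w\<bar> + max 0 (c - T n \<omega>)" for n \<omega>
  have g_meas [measurable]: "g n \<in> borel_measurable M" for n
    unfolding g_def by measurable
  have g_bound: "\<bar>g n \<omega>\<bar> \<le> 2 * \<bar>c\<bar> + \<bar>w\<bar>" for n \<omega>
    using le[of n \<omega>] unfolding g_def by linarith
  have int_g: "integrable M (g n)" for n
    by (rule integrable_const_bound[of _ "2 * \<bar>c\<bar> + \<bar>w\<bar>"]) (simp_all add: g_bound g_meas)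
  have lim_g: "(\<lambda>n. expectation (g n)) \<longlonglongrightarrow> expectation (\<lambda>_. 0)"
  proof (rule integral_dominated_convergence)
    show "AE \<omega> in M. (\<lambda>n. g n \<omega>) \<longlonglongrightarrow> 0"
      using W_lim T_lim
    proof eventually_elim
      case (elim \<omega>)
      have "(\<lambda>n. g n \<omega>) \<longlonglongrightarrow> \<bar>min w c - w\<bar> + max 0 (c - c)"
        unfolding g_def
        by (intro tendsto_add tendsto_rabs tendsto_diff tendsto_min tendsto_max tendsto_const elim)
      then show ?case using \<open>w \<le> c\<close> by simp
    qed
    show "integrable M (\<lambda>_. 2 * \<bar>c\<bar> + \<bar>w\<bar>)" by simp
  qed (simp_all add: g_bound g_meas)
  have upper: "expectation (\<lambda>\<omega>. \<bar>W n \<omega> - w\<bar>) \<le> expectation (g n) + (expectation (T n) - c)" for n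
  proof -
    have "expectation (\<lambda>\<omega>. \<bar>W n \<omega> - w\<bar>) \<le> expectation (\<lambda>\<omega>. g n \<omega> + (T n \<omega> - c))"
    proof (rule integral_mono)
      show "\<bar>W n \<omega> - w\<bar> \<le> g n \<omega> + (T n \<omega> - c)" for \<omega>
        using le[of n \<omega>] \<open>w \<le> c\<close> unfolding g_def by linarith
    qed (use int_W int_g T in auto)
    also have "\<dots> = expectation (g n) + (expectation (T n) - c)"
      using int_g T by (simp add: prob_space)
    finally show ?thesis .
  qed
  have "(\<lambda>n. expectation (g n) + (expectation (T n) - c)) \<longlonglongrightarrow> 0 + (c - c)"
    using lim_g by (intro tendsto_add tendsto_diff ET_lim tendsto_const) simp
  then have "(\<lambda>n. expectation (\<lambda>\<omega>. \<bar>W n \<omega> - w\<bar>)) \<longlonglongrightarrow> 0"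
    by (intro tendsto_sandwich[OF _ always_eventually[OF allI[OF upper]] tendsto_const]) simp_all
  then show ?thesis
    using int_W by (simp add: tendsto_L1_def)
qed

end

section \<open>Diameters of sequences and walks\<close>

lemma diameter_finite_eq_Max:
  assumes "finite S" "S \<noteq> {}"
  shows "diameter S = Max ((\<lambda>(x, y). dist x y) ` (S \<times> S))"
  using assms unfolding diameter_def by (simp add: cSup_eq_Max)

lemma dist_le_diameter_image:
  fixes s :: "nat \<Rightarrow> 'b::metric_space"
  assumes "i \<le> n" "j \<le> n"
  shows "dist (s i) (s j) \<le> diameter (s ` {0..n})"
  by (rule diameter_bounded_bound) (use assms in \<open>auto intro: finite_imp_bounded\<close>)

text \<open>The lower bound is the distance between the two endpoints. For the upper bound,
  \<open>s k\<close> differs from \<open>k \<mu>\<close> by at most \<open>C + e k\<close>, so any two of the points up to time \<open>n\<close> are within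
  \<open>n norm \<mu> + 2 (C + e n)\<close> of each other.\<close>

lemma diameter_asymptotics:
  fixes s :: "nat \<Rightarrow> 'b::real_normed_vector"
  assumes lim: "(\<lambda>n. s n /\<^sub>R real n) \<longlonglongrightarrow> \<mu>"
  shows "(\<lambda>n. diameter (s ` {0..n}) / real n) \<longlonglongrightarrow> norm \<mu>"
proof (rule order_tendstoI)
  fix a assume a: "a < norm \<mu>"
  have "(\<lambda>n. norm (s n /\<^sub>R real n - s 0 /\<^sub>R real n)) \<longlonglongrightarrow> norm (\<mu> - 0)"
    by (intro tendsto_intros lim tendsto_scaleR[of _ 0 _ _ "s 0", simplified] lim_inverse_n)
  then have "eventually (\<lambda>n. a < norm (s n /\<^sub>R real n - s 0 /\<^sub>R real n)) sequentially"
    by (rule order_tendstoD) (use a in simp)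
  then show "eventually (\<lambda>n. a < diameter (s ` {0..n}) / real n) sequentially"
  proof eventually_elim
    case (elim n)
    also have "norm (s n /\<^sub>R real n - s 0 /\<^sub>R real n) = dist (s n) (s 0) / real n"
      by (simp add: dist_norm divide_inverse mult.commute flip: scaleR_diff_right)
    also have "\<dots> \<le> diameter (s ` {0..n}) / real n"
      by (intro divide_right_mono dist_le_diameter_image) auto
    finally show ?case .
  qed
next
  fix a assume a: "norm \<mu> < a"
  \<comment> \<open>The upper bound costs \<open>2 e\<close>, absorbing \<open>2 C / n\<close> costs one more \<open>e\<close>, and the fourth is slack.\<close>
  define e where "e = (a - norm \<mu>) / 4"
  have "0 < e" using a by (simp add: e_def)
  define r where "r k = norm (s k - real k *\<^sub>R \<mu>)" for k
  from tendstoD[OF lim \<open>0 < e\<close>] obtain N where N: "\<And>n. N \<le> n \<Longrightarrow> dist (s n /\<^sub>R real n) \<mu> < e"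
    by (auto simp: eventually_sequentially)
  define C where "C = (\<Sum>k\<le>N. r k)"
  have r_le: "r k \<le> C + e * real k" for k
  proof (cases "k \<le> N")
    case True
    then have "r k \<le> C"
      unfolding C_def by (intro member_le_sum) (auto simp: r_def)
    then show ?thesis using \<open>0 < e\<close> by (simp add: add_increasing2)
  next
    case False
    then have "s k - real k *\<^sub>R \<mu> = real k *\<^sub>R (s k /\<^sub>R real k - \<mu>)"
      by (simp add: scaleR_diff_right)
    then have "r k = real k * dist (s k /\<^sub>R real k) \<mu>"
      by (simp add: r_def dist_norm)
    also have "\<dots> \<le> real k * e"
      using N[of k] False by (intro mult_left_mono) auto
    also have "\<dots> \<le> C + e * real k"
      by (simp add: C_def r_def sum_nonneg)
    finally show ?thesis .
  qed
  have upper: "diameter (s ` {0..n}) \<le> real n * norm \<mu> + 2 * C + 2 * e * real n" for n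
  proof (rule diameter_le)
    fix x y assume "x \<in> s ` {0..n}" "y \<in> s ` {0..n}"
    then obtain i j where ij: "x = s i" "y = s j" "i \<le> n" "j \<le> n" by auto
    have "x - y = (s i - real i *\<^sub>R \<mu>) - (s j - real j *\<^sub>R \<mu>) + (real i - real j) *\<^sub>R \<mu>"
      by (simp add: ij scaleR_diff_left)
    also have "norm \<dots> \<le> r i + r j + norm ((real i - real j) *\<^sub>R \<mu>)"
      unfolding r_def by (intro norm_triangle_le add_mono norm_triangle_ineq4 order_refl)
    also have "\<dots> \<le> (C + e * real n) + (C + e * real n) + real n * norm \<mu>"
    proof (intro add_mono)
      show "r i \<le> C + e * real n" "r j \<le> C + e * real n"
        using ij \<open>0 < e\<close> by (auto intro!: order_trans[OF r_le] mult_left_mono)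
      show "norm ((real i - real j) *\<^sub>R \<mu>) \<le> real n * norm \<mu>"
        using ij by (auto intro!: mult_right_mono)
    qed
    finally show "norm (x - y) \<le> real n * norm \<mu> + 2 * C + 2 * e * real n"
      by (simp add: algebra_simps)
  qed auto
  have "eventually (\<lambda>n. 2 * C / e < real n \<and> 0 < n) sequentially"
    by (intro eventually_conj eventually_gt_at_top
        filterlim_at_top_dense[THEN iffD1, OF filterlim_real_sequentially, rule_format])
  then show "eventually (\<lambda>n. diameter (s ` {0..n}) / real n < a) sequentially"
  proof eventually_elim
    case (elim n)
    then have "2 * C < e * real n"
      using \<open>0 < e\<close> by (simp add: field_simps)
    with upper[of n] have "diameter (s ` {0..n}) < real n * norm \<mu> + 3 * (e * real n)"
      by linarith
    also have "\<dots> = (norm \<mu> + 3 * e) * real n"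
      by (simp add: algebra_simps)
    also have "\<dots> \<le> a * real n"
      using \<open>0 < e\<close> by (intro mult_right_mono) (auto simp: e_def field_simps)
    finally show ?case using elim by (simp add: field_simps)
  qed
qed

lemma walk_diameter_nonneg: "0 \<le> walk_diameter Z n \<omega>"
  unfolding walk_diameter_def by (intro diameter_ge_0 finite_imp_bounded) simp

lemma norm_step_le_walk_diameter: "norm (Z (Suc n) \<omega>) \<le> walk_diameter Z (Suc n) \<omega>"
  using dist_le_diameter_image[where i = "Suc n" and j = n and n = "Suc n" and s = "\<lambda>k. walk Z k \<omega>"]
  by (simp add: walk_diameter_def walk_def dist_norm)

lemma walk_diameter_le_sum_norm: "walk_diameter Z n \<omega> \<le> (\<Sum>k<n. norm (Z (Suc k) \<omega>))"
proof -
  have walk: "walk Z j \<omega> = (\<Sum>k<j. Z (Suc k) \<omega>)" for j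
    by (induction j) (simp_all add: walk_def)
  have *: "norm (walk Z j \<omega> - walk Z i \<omega>) \<le> (\<Sum>k<n. norm (Z (Suc k) \<omega>))" if "i \<le> j" "j \<le> n" for i j
  proof -
    have "walk Z j \<omega> - walk Z i \<omega> = (\<Sum>k\<in>{..<j} - {..<i}. Z (Suc k) \<omega>)"
      unfolding walk using that by (intro sum_diff[symmetric]) auto
    also have "norm \<dots> \<le> (\<Sum>k\<in>{..<j} - {..<i}. norm (Z (Suc k) \<omega>))"
      by (rule norm_sum)
    also have "\<dots> \<le> (\<Sum>k<n. norm (Z (Suc k) \<omega>))"
      using that by (intro sum_mono2) auto
    finally show ?thesis .
  qed
  show ?thesis
    unfolding walk_diameter_def
  proof (rule diameter_le)
    fix x y assume "x \<in> (\<lambda>k. walk Z k \<omega>) ` {0..n}" "y \<in> (\<lambda>k. walk Z k \<omega>) ` {0..n}"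
    then obtain i j where ij: "x = walk Z i \<omega>" "y = walk Z j \<omega>" "i \<le> n" "j \<le> n" by auto
    then show "norm (x - y) \<le> (\<Sum>k<n. norm (Z (Suc k) \<omega>))"
      using *[of i j] *[of j i] by (cases i j rule: le_cases) (simp_all add: norm_minus_commute)
  qed auto
qed

text \<open>The supremum in the diameter ranges over a random set of pairs of points; indexed by pairs of times it
  is a maximum over a fixed finite set.\<close>

lemma borel_measurable_walk_diameter:
  assumes "\<And>k. 1 \<le> k \<Longrightarrow> Z k \<in> borel_measurable M"
  shows "walk_diameter Z n \<in> borel_measurable M"
proof -
  have [measurable]: "walk Z k \<in> borel_measurable M" for k
    unfolding walk_def by (intro borel_measurable_sum assms) simp
  have eq: "walk_diameter Z n = (\<lambda>\<omega>. Max ((\<lambda>p. dist (walk Z (fst p) \<omega>) (walk Z (snd p) \<omega>)) ` ({0..n} \<times> {0..n})))"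
  proof
    fix \<omega>
    have "(\<lambda>(x, y). dist x y) ` ((\<lambda>k. walk Z k \<omega>) ` {0..n} \<times> (\<lambda>k. walk Z k \<omega>) ` {0..n})
        = (\<lambda>p. dist (walk Z (fst p) \<omega>) (walk Z (snd p) \<omega>)) ` ({0..n} \<times> {0..n})"
      by force
    then show "walk_diameter Z n \<omega> = Max ((\<lambda>p. dist (walk Z (fst p) \<omega>) (walk Z (snd p) \<omega>)) ` ({0..n} \<times> {0..n}))"
      unfolding walk_diameter_def by (subst diameter_finite_eq_Max) auto
  qed
  show ?thesis
    unfolding eq by (intro borel_measurable_Max) auto
qed

section \<open>Growth of the diameter\<close>

theorem theorem1p3:
  fixes M :: "'w measure"
    and Z :: "'w \<Rightarrow> real ^ 2"
    and Zs :: "nat \<Rightarrow> 'w \<Rightarrow> real ^ 2"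
  assumes "prob_space M"
    and "Z \<in> borel_measurable M"
    and "prob_space.indep_vars M (\<lambda>_. borel) Zs {1..}"
    and "\<And>k. k \<ge> 1 \<Longrightarrow> distr M borel (Zs k) = distr M borel Z"
  shows "((\<integral>\<^sup>+\<omega>. ennreal (norm (Z \<omega>)) \<partial>M) < \<infinity> \<longrightarrow>
            (let \<mu> = (\<integral>\<omega>. Z \<omega> \<partial>M) in
               (AE \<omega> in M. (\<lambda>n. walk_diameter Zs n \<omega> / real n) \<longlonglongrightarrow> norm \<mu>) \<and>
               tendsto_L1 M (\<lambda>n \<omega>. walk_diameter Zs n \<omega> / real n) (\<lambda>_. norm \<mu>)))
       \<and> ((\<integral>\<^sup>+\<omega>. ennreal (norm (Z \<omega>)) \<partial>M) = \<infinity> \<longrightarrow>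
            (AE \<omega> in M. limsup (\<lambda>n. ereal (walk_diameter Zs n \<omega> / real n)) = \<infinity>))"
proof -
  interpret prob_space M by fact
  note Z [measurable] = \<open>Z \<in> borel_measurable M\<close>
  define X where "X = (\<lambda>k. Zs (Suc k))"
  have indep: "indep_vars (\<lambda>_. borel) X UNIV"
    using indep_vars_reindex[OF assms(3), of Suc UNIV] by (auto simp: X_def)
  have Zs [measurable]: "Zs k \<in> borel_measurable M" if "1 \<le> k" for k
    using indep_vars_random_variable[OF assms(3), of k] that by simp
  have X [measurable]: "X k \<in> borel_measurable M" for k
    by (rule indep_vars_random_variable[OF indep UNIV_I])
  have X_Z: "distr M borel (X k) = distr M borel Z" for k
    unfolding X_def by (rule assms(4)) simp
  have ident: "distr M borel (X k) = distr M borel (X 0)" for k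
    by (rule trans[OF X_Z X_Z[symmetric]])
  have norm_X_Z: "distr M borel (\<lambda>\<omega>. norm (X k \<omega>)) = distr M borel (\<lambda>\<omega>. norm (Z \<omega>))" for k
    by (rule identically_distributed_compose[OF _ _ _ X_Z]) measurable
  have walk_eq: "walk Zs n \<omega> = (\<Sum>k<n. X k \<omega>)" for n \<omega>
    by (induction n) (simp_all add: walk_def X_def)
  show ?thesis
  proof (intro conjI impI)
    assume "(\<integral>\<^sup>+\<omega>. ennreal (norm (Z \<omega>)) \<partial>M) < \<infinity>"
    then have int_Z: "integrable M Z"
      by (simp add: integrable_iff_bounded)
    define \<mu> where "\<mu> = (\<integral>\<omega>. Z \<omega> \<partial>M)"
    define c where "c = expectation (\<lambda>\<omega>. norm (Z \<omega>))"
    have int_X: "integrable M (X k)" for k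
      using identically_distributed_integral(1)[OF X Z X_Z] int_Z by blast
    have E_X: "(\<integral>\<omega>. X 0 \<omega> \<partial>M) = \<mu>"
      unfolding \<mu>_def by (rule identically_distributed_integral(2)[OF X Z X_Z])
    have E_norm_X: "expectation (\<lambda>\<omega>. norm (X k \<omega>)) = c" for k
      unfolding c_def by (rule identically_distributed_integral(2)[OF _ _ norm_X_Z]) measurable
    have lim: "AE \<omega> in M. (\<lambda>n. walk_diameter Zs n \<omega> / real n) \<longlonglongrightarrow> norm \<mu>"
      using strong_law_euclidean[OF indep ident int_X]
    proof eventually_elim
      case (elim \<omega>)
      then show ?case
        unfolding walk_diameter_def by (intro diameter_asymptotics) (simp add: walk_eq E_X)
    qed
    let ?T = "\<lambda>n \<omega>. (\<Sum>k<n. norm (X k \<omega>)) / real n"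
    have "tendsto_L1 M (\<lambda>n \<omega>. walk_diameter Zs n \<omega> / real n) (\<lambda>_. norm \<mu>)"
    proof (rule tendsto_L1_squeeze[where T = ?T and c = c])
      show "(\<lambda>\<omega>. walk_diameter Zs n \<omega> / real n) \<in> borel_measurable M" for n
        by (intro borel_measurable_divide borel_measurable_walk_diameter Zs) simp_all
      show "integrable M (?T n)" for n
        using int_X by simp
      show "0 \<le> walk_diameter Zs n \<omega> / real n" for n \<omega>
        by (simp add: walk_diameter_nonneg)
      show "walk_diameter Zs n \<omega> / real n \<le> ?T n \<omega>" for n \<omega>
        unfolding X_def by (intro divide_right_mono walk_diameter_le_sum_norm) simp
      show "AE \<omega> in M. (\<lambda>n. ?T n \<omega>) \<longlonglongrightarrow> c"
        unfolding E_norm_X[of 0, symmetric]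
      proof (rule strong_law_real[where X = "\<lambda>k \<omega>. norm (X k \<omega>)"])
        show "indep_vars (\<lambda>_. borel) (\<lambda>k \<omega>. norm (X k \<omega>)) UNIV"
          by (rule indep_vars_compose2[OF indep]) simp
        show "distr M borel (\<lambda>\<omega>. norm (X k \<omega>)) = distr M borel (\<lambda>\<omega>. norm (X 0 \<omega>))" for k
          by (rule trans[OF norm_X_Z norm_X_Z[symmetric]])
        show "integrable M (\<lambda>\<omega>. norm (X 0 \<omega>))"
          using int_X by (rule integrable_norm)
      qed
      have "expectation (?T n) = c" if "0 < n" for n
        using that int_X by (simp add: E_norm_X)
      then show "(\<lambda>n. expectation (?T n)) \<longlonglongrightarrow> c"
        by (intro tendsto_eventually eventually_sequentiallyI[of 1]) auto
    qed (rule lim)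
    with lim show "let \<mu> = (\<integral>\<omega>. Z \<omega> \<partial>M) in
        (AE \<omega> in M. (\<lambda>n. walk_diameter Zs n \<omega> / real n) \<longlonglongrightarrow> norm \<mu>) \<and>
        tendsto_L1 M (\<lambda>n \<omega>. walk_diameter Zs n \<omega> / real n) (\<lambda>_. norm \<mu>)"
      by (simp add: \<mu>_def Let_def)
  next
    have norm_Z: "(\<lambda>\<omega>. norm (Z \<omega>)) \<in> borel_measurable M"
      by measurable
    assume inf: "(\<integral>\<^sup>+\<omega>. ennreal (norm (Z \<omega>)) \<partial>M) = \<infinity>"
    \<comment> \<open>Infinitely often the last step alone is longer than \<open>Suc m\<close> times the number of steps.\<close>
    have "AE \<omega> in M. \<exists>\<^sub>\<infinity>n. real (Suc m) < walk_diameter Zs n \<omega> / real n" for m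
    proof -
      define A where "A k = {\<omega>\<in>space M. real (Suc m) * real (Suc k) < norm (X k \<omega>)}" for k
      have "indep_events A UNIV"
        unfolding A_def
        by (rule indep_eventsI_indep_vars[OF indep, where P = "\<lambda>k x. real (Suc m) * real (Suc k) < norm x"])
          measurable
      moreover have "\<not> summable (\<lambda>k. prob (A k))"
      proof -
        have "prob (A k) = prob {\<omega>\<in>space M. real (Suc m) * real (Suc k) < norm (Z \<omega>)}" for k
        proof -
          have *: "prob {\<omega>\<in>space M. real (Suc m) * real (Suc k) < norm (Y \<omega>)}
              = measure (distr M borel (\<lambda>\<omega>. norm (Y \<omega>))) {real (Suc m) * real (Suc k)<..}"
            if [measurable]: "Y \<in> borel_measurable M" for Y :: "'w \<Rightarrow> real ^ 2"
            by (subst measure_distr) (auto intro!: arg_cong[where f = prob])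
          show ?thesis
            unfolding A_def *[OF X] *[OF Z] norm_X_Z ..
        qed
        moreover have "\<not> summable (\<lambda>k. prob {\<omega>\<in>space M. real (Suc m) * real k < norm (Z \<omega>)})"
          by (rule tail_not_summable[OF norm_Z _ inf]) simp
        ultimately show ?thesis
          using summable_Suc_iff[of "\<lambda>k. prob {\<omega>\<in>space M. real (Suc m) * real k < norm (Z \<omega>)}"]
          by (simp only: not_False_eq_True)
      qed
      ultimately have "AE \<omega> in M. \<exists>\<^sub>\<infinity>k. \<omega> \<in> A k"
        by (rule borel_cantelli_independent)
      then show ?thesis
      proof eventually_elim
        case (elim \<omega>)
        have *: "real (Suc m) < walk_diameter Zs (Suc k) \<omega> / real (Suc k)" if "\<omega> \<in> A k" for k
        proof -
          have "real (Suc m) * real (Suc k) < walk_diameter Zs (Suc k) \<omega>"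
            using that norm_step_le_walk_diameter[of Zs k \<omega>] by (simp add: A_def X_def)
          then show ?thesis
            by (simp add: pos_less_divide_eq)
        qed
        show ?case
          unfolding INFM_nat_le
        proof
          fix N
          obtain k where "N \<le> k" "\<omega> \<in> A k"
            using elim unfolding INFM_nat_le by blast
          then show "\<exists>n\<ge>N. real (Suc m) < walk_diameter Zs n \<omega> / real n"
            using *[of k] by (intro exI[of _ "Suc k"]) auto
        qed
      qed
    qed
    then have "AE \<omega> in M. \<forall>m. \<exists>\<^sub>\<infinity>n. real (Suc m) < walk_diameter Zs n \<omega> / real n"
      by (simp add: AE_all_countable)
    then show "AE \<omega> in M. limsup (\<lambda>n. ereal (walk_diameter Zs n \<omega> / real n)) = \<infinity>"
    proof eventually_elim
      case (elim \<omega>)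
      show ?case
      proof (rule ereal_top)
        fix B :: real
        obtain m :: nat where "B \<le> real m"
          using real_arch_simple by blast
        show "ereal B \<le> limsup (\<lambda>n. ereal (walk_diameter Zs n \<omega> / real n))"
        proof (rule ccontr)
          assume "\<not> ?thesis"
          then have "eventually (\<lambda>n. ereal (walk_diameter Zs n \<omega> / real n) < ereal B) sequentially"
            by (intro Limsup_lessD) (simp add: not_le)
          then obtain N where "\<And>n. N \<le> n \<Longrightarrow> walk_diameter Zs n \<omega> / real n < B"
            by (auto simp: eventually_sequentially)
          moreover obtain n where "N \<le> n" "real (Suc m) < walk_diameter Zs n \<omega> / real n"
            using elim unfolding INFM_nat_le by blast
          ultimately show False
            using \<open>B \<le> real m\<close> by force
        qed
      qed
    qed
  qed
qed

end
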